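(* There is $\varepsilon=\frac{1}{2^{O(\sqrt{\log n})}}$ such that any $(1\pm\varepsilon)$ cut-sketching scheme for directed hypergraphs on $n$ vertices must have worst-case space $\frac{n^3}{2^{O(\sqrt{\log n})}}$ bits.
   Context: A directed hypergraph $H=(V,E)$ has directed hyperedges $e=(L(e),R(e))$ with $L(e),R(e)\subseteq V$. For $S\subseteq V$, $\mathrm{cut}_H(S)$ is the (weighted) number of hyperedges $e$ with $L(e)\cap S\ne\emptyset$ and $R(e)\cap(V\setminus S)\ne\emptyset$ (equivalently $\mathbf{1}_S^T L_H\mathbf{1}_S$ where $x^TL_Hx=\sum_e w_e\max_{u\in L(e),v\in R(e)}(x_u-x_v)_+^2$). A $(1\pm\varepsilon)$ cut-sketching scheme assigns to each directed hypergraph $H$ on $n$ vertices a bit string (sketch) such that for every $S\subseteq V$ one can deterministically compute from the sketch and $S$ alone a value within a factor $(1\pm\varepsilon)$ of $\mathrm{cut}_H(S)$; its worst-case space is the maximum length of a sketch. *)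

theory Defs
  imports
    "HOL-Analysis.Analysis"
    "HOL-Library.Landau_Symbols"
    "HOL-Library.Extended_Nat"
begin

(* A directed hyperedge e is the pair (L(e), R(e)). *)
type_synonym 'v hyperedge = "'v set \<times> 'v set"

record 'v hypergraph =
  verts :: "'v set"
  edges :: "'v hyperedge set"
  weight :: "'v hyperedge \<Rightarrow> real"

(* The weight is fixed to 0 off the edge set, so that equality of records is equality of
   weighted hypergraphs and a sketch cannot depend on irrelevant values of the weight. *)
definition directed_hypergraph :: "'v hypergraph \<Rightarrow> bool" where
  "directed_hypergraph H \<longleftrightarrow>
     finite (verts H) \<and>
     (\<forall>e \<in> edges H. fst e \<subseteq> verts H \<and> snd e \<subseteq> verts H) \<and>
     (\<forall>e \<in> edges H. weight H e > 0) \<and>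
     (\<forall>e. e \<notin> edges H \<longrightarrow> weight H e = 0)"

definition cut :: "'v hypergraph \<Rightarrow> 'v set \<Rightarrow> real" where
  "cut H S =
     (\<Sum>e | e \<in> edges H \<and> fst e \<inter> S \<noteq> {} \<and> snd e \<inter> (verts H - S) \<noteq> {}. weight H e)"

(* W is the set of admissible weights: W = {1} gives the unweighted hypergraphs,
   for which cut is a plain number of hyperedges, and W = {0<..} all weighted ones. *)
definition hypergraphs_on :: "nat \<Rightarrow> real set \<Rightarrow> nat hypergraph set" where
  "hypergraphs_on n W =
     {H. directed_hypergraph H \<and> verts H = {..<n} \<and> weight H ` edges H \<subseteq> W}"

(* The decoder sees only the bit string and S (and may depend on n, W and eps,
   which are fixed with the scheme). *)
definition cut_sketching_scheme ::
  "nat \<Rightarrow> real set \<Rightarrow> real \<Rightarrow> (nat hypergraph \<Rightarrow> bool list)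
     \<Rightarrow> (bool list \<Rightarrow> nat set \<Rightarrow> real) \<Rightarrow> bool" where
  "cut_sketching_scheme n W eps sketch decode \<longleftrightarrow>
     (\<forall>H \<in> hypergraphs_on n W. \<forall>S \<subseteq> verts H.
        (1 - eps) * cut H S \<le> decode (sketch H) S \<and>
        decode (sketch H) S \<le> (1 + eps) * cut H S)"

(* The supremum is a maximum for W = {1} (or any finite W), where there are only finitely many
   hypergraphs; it is infinite if the lengths of the sketches are unbounded. *)
definition worst_case_space ::
  "nat \<Rightarrow> real set \<Rightarrow> (nat hypergraph \<Rightarrow> bool list) \<Rightarrow> enat" where
  "worst_case_space n W sketch = (SUP H \<in> hypergraphs_on n W. enat (length (sketch H)))"

end

theory Submission
  imports Defs
begin

text \<open>
  Let \<open>A \<subseteq> {0..<m}\<close> be Behrend's set without 3-term progressions, \<open>|A| \<ge> m / 2^O(\<surd>log m)\<close>. The pairs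
  \<open>(x, x + a)\<close> with \<open>a \<in> A\<close> form a Ruzsa--Szemeredi graph: for each \<open>z\<close>, those with \<open>x + 2a = z\<close> form
  an induced matching. A set \<open>X\<close> of triples \<open>(u, x, a)\<close>, with \<open>u, x < m\<close> and \<open>a \<in> A\<close>, is
  encoded by the hyperedges from \<open>u\<close> to a private vertex of \<open>x\<close> together with the vertices
  \<open>x + a\<close> such that \<open>(u, x, a) \<in> X\<close>. For fixed \<open>u\<close> and \<open>z\<close>, cutting all private vertices outside
  the matching makes the contribution of the other hyperedges at \<open>u\<close> a known constant, so a cut
  value, which is at most \<open>m\<close>, counts the triples of \<open>X\<close> in any chosen part of the matching, up
  to an error of \<open>O(\<epsilon>m)\<close>. Hence two sets with the same sketch differ in at most
  \<open>O(\<epsilon>m\<^sup>3)\<close> triples, which is at most one sixteenth of all \<open>m\<^sup>2|A|\<close> triples. A Hamming ball of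
  that radius contains few sets, so there are \<open>2^\<Omega>(m\<^sup>2|A|)\<close> different sketches.
\<close>

section \<open>Progression-free sets of integers\<close>

lemma sum_power_less:
  fixes x :: "nat \<Rightarrow> nat"
  assumes "\<And>i. i < k \<Longrightarrow> x i < b"
  shows "(\<Sum>i<k. x i * b ^ i) < b ^ k"
  using assms
proof (induction k)
  case (Suc k)
  have "x k * b ^ k + b ^ k \<le> b * b ^ k"
    using mult_right_mono[of "Suc (x k)" b "b ^ k"] Suc.prems[of k] by simp
  moreover have "(\<Sum>i<k. x i * b ^ i) < b ^ k" using Suc by simp
  ultimately show ?case by simp
qed simp

lemma digits_unique:
  fixes x y :: "nat \<Rightarrow> nat"
  assumes "\<And>i. i < k \<Longrightarrow> x i < b" "\<And>i. i < k \<Longrightarrow> y i < b"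
    and "(\<Sum>i<k. x i * b ^ i) = (\<Sum>i<k. y i * b ^ i)" and "j < k"
  shows "x j = y j"
  using assms
proof (induction k arbitrary: x y j)
  case (Suc k)
  have shift: "(\<Sum>i<Suc k. v i * b ^ i) = v 0 + b * (\<Sum>i<k. v (Suc i) * b ^ i)" for v :: "nat \<Rightarrow> nat"
    unfolding sum.lessThan_Suc_shift by (simp add: sum_distrib_left ac_simps)
  have eq: "x 0 + b * (\<Sum>i<k. x (Suc i) * b ^ i) = y 0 + b * (\<Sum>i<k. y (Suc i) * b ^ i)"
    using Suc.prems(3) unfolding shift .
  have less: "x 0 < b" "y 0 < b" using Suc.prems by auto
  have "x 0 = y 0" using arg_cong[OF eq, of "\<lambda>v. v mod b"] less by simp
  with eq less have *: "(\<Sum>i<k. x (Suc i) * b ^ i) = (\<Sum>i<k. y (Suc i) * b ^ i)" by simp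
  have tail: "x (Suc i) = y (Suc i)" if "i < k" for i
    by (rule Suc.IH[of "\<lambda>i. x (Suc i)" "\<lambda>i. y (Suc i)"]) (use Suc.prems * that in auto)
  with \<open>x 0 = y 0\<close> Suc.prems(4) show ?case by (cases j) auto
qed simp

definition AP3_free :: "nat set \<Rightarrow> bool" where
  "AP3_free A \<longleftrightarrow> (\<forall>a\<in>A. \<forall>b\<in>A. \<forall>c\<in>A. a + b = 2 * c \<longrightarrow> a = b)"

lemma AP3_freeD:
  assumes "AP3_free A" "a \<in> A" "b \<in> A" "c \<in> A" "a + b = 2 * c"
  shows "a = c" "b = c"
  using assms unfolding AP3_free_def by fastforce+

text \<open>
  A sphere contains no three collinear points, and adding two vectors with entries below \<open>d\<close>
  produces no carries in base \<open>2d\<close>.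
\<close>

lemma AP3_free_sphere:
  fixes d k s :: nat
  defines "V \<equiv> {x \<in> {..<k} \<rightarrow>\<^sub>E {..<d}. (\<Sum>i<k. (x i)\<^sup>2) = s}"
  defines "\<phi> \<equiv> \<lambda>x. \<Sum>i<k. x i * (2 * d) ^ i"
  shows "AP3_free (\<phi> ` V)" "inj_on \<phi> V" "\<phi> ` V \<subseteq> {..<(2 * d) ^ k}"
proof -
  have less: "x i < d" if "x \<in> V" "i < k" for x i
    using that unfolding V_def by (auto simp: PiE_def Pi_def)
  show "\<phi> ` V \<subseteq> {..<(2 * d) ^ k}"
  proof (rule image_subsetI)
    fix x assume "x \<in> V"
    then have "x i < 2 * d" if "i < k" for i using less[OF _ that, of x] by simp
    then show "\<phi> x \<in> {..<(2 * d) ^ k}" unfolding \<phi>_def using sum_power_less[of k x "2 * d"] by simp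
  qed
  show "inj_on \<phi> V"
  proof (rule inj_onI)
    fix x y assume xy: "x \<in> V" "y \<in> V" "\<phi> x = \<phi> y"
    have "x i = y i" if "i < k" for i
      using digits_unique[of k x "2 * d" y i] less[OF xy(1)] less[OF xy(2)] xy(3) that
      unfolding \<phi>_def by fastforce
    moreover have "x \<in> {..<k} \<rightarrow>\<^sub>E {..<d}" "y \<in> {..<k} \<rightarrow>\<^sub>E {..<d}" using xy unfolding V_def by auto
    ultimately show "x = y" by (metis PiE_ext lessThan_iff)
  qed
  show "AP3_free (\<phi> ` V)"
    unfolding AP3_free_def
  proof (intro ballI impI, clarify)
    fix x y z assume V: "x \<in> V" "y \<in> V" "z \<in> V" and eq: "\<phi> x + \<phi> y = 2 * \<phi> z"
    have "(\<Sum>i<k. (x i + y i) * (2 * d) ^ i) = (\<Sum>i<k. (2 * z i) * (2 * d) ^ i)"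
      using eq unfolding \<phi>_def by (simp add: sum.distrib sum_distrib_left algebra_simps)
    then have mid: "x i + y i = 2 * z i" if "i < k" for i
      using digits_unique[of k "\<lambda>i. x i + y i" "2 * d" "\<lambda>i. 2 * z i" i]
        less[OF V(1)] less[OF V(2)] less[OF V(3)] that by fastforce
    have sq: "(\<Sum>i<k. (int (v i))\<^sup>2) = int s" if "v \<in> V" for v
      using that unfolding V_def by (auto simp flip: of_nat_power of_nat_sum)
    \<comment> \<open>Parallelogram law with midpoint \<open>z\<close>. Summed over a sphere the
      right-hand side is 2s + 2s - 4s = 0. Working in \<open>int\<close> avoids truncated
      subtraction.\<close>
    have "(int (x i) - int (y i))\<^sup>2 = 2 * (int (x i))\<^sup>2 + 2 * (int (y i))\<^sup>2 - 4 * (int (z i))\<^sup>2"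
      if "i < k" for i
    proof -
      have y: "int (y i) = 2 * int (z i) - int (x i)" using mid[OF that] by simp
      show ?thesis unfolding y by (simp add: power2_eq_square algebra_simps)
    qed
    then have "(\<Sum>i<k. (int (x i) - int (y i))\<^sup>2)
        = (\<Sum>i<k. 2 * (int (x i))\<^sup>2 + 2 * (int (y i))\<^sup>2 - 4 * (int (z i))\<^sup>2)"
      by (intro sum.cong) auto
    also have "\<dots> = 0"
      using sq[OF V(1)] sq[OF V(2)] sq[OF V(3)]
      by (simp add: sum.distrib sum_subtractf flip: sum_distrib_left)
    finally have "x i = y i" if "i < k" for i
      using that by (subst (asm) sum_nonneg_eq_0_iff) auto
    moreover have "x \<in> {..<k} \<rightarrow>\<^sub>E {..<d}" "y \<in> {..<k} \<rightarrow>\<^sub>E {..<d}" using V unfolding V_def by auto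
    ultimately have "x = y" by (metis PiE_ext lessThan_iff)
    then show "\<phi> x = \<phi> y" by simp
  qed
qed

text \<open>Pigeonhole over the possible squared norms of vectors in dimension \<open>t\<close> with
  entries below \<open>d = 2 ^ t\<close>; some sphere is large. The loss \<open>2 ^ (4 * t)\<close>
  is a factor \<open>8 ^ t\<close> for the number of spheres and a factor \<open>2 ^ t\<close> for
  reading the digits in base \<open>2 * d\<close> instead of \<open>d\<close>. Equal orders of
  dimension and log d keep the loss at 2 to the O(sqrt(log m)).\<close>

lemma Behrend:
  fixes t :: nat
  obtains A where "A \<subseteq> {..<2 ^ (t * (t + 1))}" "AP3_free A"
    "2 ^ (t * (t + 1)) \<le> 2 ^ (4 * t) * card A"
proof -
  define d :: nat where "d = 2 ^ t"
  let ?P = "{..<t} \<rightarrow>\<^sub>E {..<d}" and ?q = "\<lambda>x :: nat \<Rightarrow> nat. \<Sum>i<t. (x i)\<^sup>2"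
  have "?q x \<le> t * d\<^sup>2" if "x \<in> ?P" for x
    using that sum_bounded_above[of "{..<t}" "\<lambda>i. (x i)\<^sup>2" "d\<^sup>2"]
    by (force simp: PiE_def Pi_def intro: less_imp_le power_mono)
  then have "?q ` ?P \<subseteq> {..t * d\<^sup>2}" by auto
  have "card ?P \<le> (\<Sum>s\<le>t * d\<^sup>2. card {x \<in> ?P. ?q x = s})"
  proof -
    have "?P = (\<Union>s\<in>{..t * d\<^sup>2}. {x \<in> ?P. ?q x = s})"
      using \<open>?q ` ?P \<subseteq> {..t * d\<^sup>2}\<close> by auto
    then have "card ?P = card (\<Union>s\<in>{..t * d\<^sup>2}. {x \<in> ?P. ?q x = s})" by (rule arg_cong)
    also have "\<dots> \<le> (\<Sum>s\<le>t * d\<^sup>2. card {x \<in> ?P. ?q x = s})" by (rule card_UN_le) simp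
    finally show ?thesis .
  qed
  moreover have "card ?P = d ^ t" by (simp add: card_PiE)
  ultimately have total: "d ^ t \<le> (\<Sum>s\<le>t * d\<^sup>2. card {x \<in> ?P. ?q x = s})" by simp
  have "\<exists>s\<le>t * d\<^sup>2. d ^ t \<le> (t * d\<^sup>2 + 1) * card {x \<in> ?P. ?q x = s}"
  proof (rule ccontr)
    assume "\<not> ?thesis"
    then have "(t * d\<^sup>2 + 1) * card {x \<in> ?P. ?q x = s} < d ^ t" if "s \<le> t * d\<^sup>2" for s
      using that by (meson not_le)
    then have "(\<Sum>s\<le>t * d\<^sup>2. (t * d\<^sup>2 + 1) * card {x \<in> ?P. ?q x = s}) < (\<Sum>s\<le>t * d\<^sup>2. d ^ t)"
      by (intro sum_strict_mono) auto
    also have "\<dots> = (t * d\<^sup>2 + 1) * d ^ t" by simp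
    finally have "(t * d\<^sup>2 + 1) * (\<Sum>s\<le>t * d\<^sup>2. card {x \<in> ?P. ?q x = s}) < (t * d\<^sup>2 + 1) * d ^ t"
      by (simp only: sum_distrib_left)
    with total show False using mult_le_mono2 not_le by blast
  qed
  then obtain s where s: "d ^ t \<le> (t * d\<^sup>2 + 1) * card {x \<in> ?P. ?q x = s}" by blast
  define A where "A = (\<lambda>x. \<Sum>i<t. x i * (2 * d) ^ i) ` {x \<in> ?P. ?q x = s}"
  note sph = AP3_free_sphere[where k = t and d = d and s = s]
  have "card A = card {x \<in> ?P. ?q x = s}" unfolding A_def using sph(2) by (rule card_image)
  have "(2 * d) ^ t = 2 ^ (t * (t + 1))"
    by (simp add: d_def flip: power_Suc power_mult)
  have "t * 4 ^ t + 1 \<le> (8 :: nat) ^ t" 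
  proof (induction t)
    case (Suc t)
    have "Suc t * 4 ^ Suc t + 1 \<le> 8 * (t * 4 ^ t + 1)"
      by (cases t) (auto simp: algebra_simps)
    also have "\<dots> \<le> 8 ^ Suc t" using Suc.IH by simp
    finally show ?case .
  qed simp
  then have "t * d\<^sup>2 + 1 \<le> 8 ^ t" by (simp add: d_def power2_eq_square flip: power_mult_distrib)
  then have "d ^ t \<le> 8 ^ t * card A"
    using s \<open>card A = _\<close> by (metis le_trans mult_le_mono1)
  then have "2 ^ t * d ^ t \<le> 2 ^ t * 8 ^ t * card A" by simp
  moreover have "2 ^ t * d ^ t = 2 ^ (t * (t + 1))"
    using \<open>(2 * d) ^ t = _\<close> by (simp add: power_mult_distrib)
  moreover have "2 ^ t * 8 ^ t = (2 :: nat) ^ (4 * t)"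
    by (simp add: power_mult flip: power_mult_distrib)
  ultimately have "2 ^ (t * (t + 1)) \<le> 2 ^ (4 * t) * card A" by simp
  moreover have "A \<subseteq> {..<2 ^ (t * (t + 1))}" "AP3_free A"
    using sph \<open>(2 * d) ^ t = _\<close> unfolding A_def by auto
  ultimately show ?thesis using that by blast
qed

section \<open>Hamming balls and the number of sketches\<close>

lemma sum_power_card_Pow:
  fixes x :: "'a :: comm_semiring_1"
  assumes "finite U"
  shows "(\<Sum>Z\<in>Pow U. x ^ card Z) = (1 + x) ^ card U"
  using assms
proof induction
  case (insert u U)
  have "(\<Sum>Z\<in>insert u ` Pow U. x ^ card Z) = (\<Sum>Z\<in>Pow U. x * x ^ card Z)"
  proof (subst sum.reindex)
    show "inj_on (insert u) (Pow U)" using insert.hyps by (intro inj_onI) (metis insert_ident Pow_iff subsetD)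
    show "(\<Sum>Z\<in>Pow U. ((\<lambda>Z. x ^ card Z) \<circ> insert u) Z) = (\<Sum>Z\<in>Pow U. x * x ^ card Z)"
    proof (rule sum.cong)
      fix Z assume "Z \<in> Pow U"
      then have "finite Z" "u \<notin> Z" using insert.hyps finite_subset by auto
      then show "((\<lambda>Z. x ^ card Z) \<circ> insert u) Z = x * x ^ card Z" by simp
    qed simp
  qed
  moreover have "Pow U \<inter> insert u ` Pow U = {}" using insert.hyps by auto
  ultimately have "(\<Sum>Z\<in>Pow (insert u U). x ^ card Z)
      = (\<Sum>Z\<in>Pow U. x ^ card Z) + x * (\<Sum>Z\<in>Pow U. x ^ card Z)"
    using insert.hyps by (simp add: Pow_insert sum.union_disjoint sum_distrib_left)
  then show ?case using insert by (simp add: algebra_simps)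
qed simp

text \<open>Exponential weights: give \<open>Z\<close> the weight (1/8)^|Z|. With M =
  \<open>card U\<close>, every counted set weighs at least 2^(-3M/16), while all subsets together
  weigh (9/8)^M <= 2^(M/4), and 1/4 + 3/16 = 7/16.\<close>

lemma card_small_subsets:
  assumes "finite U"
  shows "real (card {Z. Z \<subseteq> U \<and> 16 * card Z \<le> card U}) \<le> 2 powr (7 / 16 * card U)"
proof -
  let ?B = "{Z. Z \<subseteq> U \<and> 16 * card Z \<le> card U}" and ?M = "real (card U)"
  have "2 powr (- 3 / 16 * ?M) \<le> (1 / 8) ^ card Z" if "Z \<in> ?B" for Z
  proof -
    have "(1 / 8 :: real) ^ card Z = 2 powr (- 3 * real (card Z))"
    proof -
      have eighth: "1 / 8 = (2 :: real) powr (- 3)" by (simp add: powr_minus)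
      have "(1 / 8 :: real) ^ card Z = (1 / 8) powr card Z" by (simp add: powr_realpow)
      also have "\<dots> = 2 powr (- 3 * real (card Z))" unfolding eighth by (rule powr_powr)
      finally show ?thesis .
    qed
    with that show ?thesis by simp
  qed
  then have "card ?B * 2 powr (- 3 / 16 * ?M) \<le> (\<Sum>Z\<in>?B. (1 / 8) ^ card Z)"
    using sum_bounded_below[of ?B "2 powr (- 3 / 16 * ?M)"] by simp
  also have "\<dots> \<le> (\<Sum>Z\<in>Pow U. (1 / 8) ^ card Z)"
    by (rule sum_mono2) (use assms in auto)
  also have "\<dots> = (9 / 8) ^ card U" by (subst sum_power_card_Pow) (use assms in auto)
  also have "\<dots> \<le> (2 powr (1 / 4)) ^ card U"
  proof (rule power_mono)
    have "(9 / 8 :: real) = ((9 / 8) ^ 4) powr (1 / 4)" by (simp add: powr_powr flip: powr_numeral)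
    also have "\<dots> \<le> 2 powr (1 / 4)" by (rule powr_mono2) (auto simp: power4_eq_xxxx)
    finally show "(9 / 8 :: real) \<le> 2 powr (1 / 4)" .
  qed simp
  also have "\<dots> = 2 powr (1 / 4 * ?M)" by (simp add: powr_powr flip: powr_realpow)
  finally have "card ?B * 2 powr (- 3 / 16 * ?M) * 2 powr (3 / 16 * ?M)
      \<le> 2 powr (1 / 4 * ?M) * 2 powr (3 / 16 * ?M)"
    by (rule mult_right_mono) simp
  then show ?thesis by (simp add: mult.assoc flip: powr_add)
qed

text \<open>Taking the symmetric difference with a fixed member maps a fibre of \<open>F\<close>
  injectively into the Hamming ball around the empty set. With M = \<open>card U\<close>, each fibre
  has at most 2^(7M/16) members, so \<open>F\<close> takes at least 2^(9M/16) values, but fewer than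
  2^(l+1) strings have length at most \<open>l\<close>.\<close>

lemma bits_lower_bound:
  fixes F :: "'a set \<Rightarrow> bool list"
  assumes "finite U" and len: "\<And>X. X \<subseteq> U \<Longrightarrow> length (F X) \<le> l"
    and near: "\<And>X Y. X \<subseteq> U \<Longrightarrow> Y \<subseteq> U \<Longrightarrow> F X = F Y \<Longrightarrow> 16 * card (sym_diff X Y) \<le> card U"
  shows "9 / 16 * card U < l + 1"
proof -
  let ?M = "real (card U)" and ?B = "{Z. Z \<subseteq> U \<and> 16 * card Z \<le> card U}"
  have fiber: "real (card {X \<in> Pow U. F X = b}) \<le> 2 powr (7 / 16 * ?M)" if b: "b \<in> F ` Pow U" for b
  proof -
    obtain Y where Y: "Y \<subseteq> U" "F Y = b" using b by blast
    have "sym_diff Y ` {X \<in> Pow U. F X = b} \<subseteq> ?B"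
      using near[OF Y(1)] Y by auto
    moreover have "inj_on (sym_diff Y) {X \<in> Pow U. F X = b}" by (rule inj_onI) blast
    moreover have "finite ?B" using assms(1) by simp
    ultimately have "card {X \<in> Pow U. F X = b} \<le> card ?B" by (intro card_inj_on_le)
    then show ?thesis using card_small_subsets[OF assms(1)] by linarith
  qed
  have "(2 :: nat) ^ card U = (\<Sum>b\<in>F ` Pow U. card {X \<in> Pow U. F X = b})"
    using sum.image_gen[of "Pow U" "\<lambda>_. 1 :: nat" F] assms(1) by (simp add: card_Pow)
  then have "2 powr ?M = (\<Sum>b\<in>F ` Pow U. real (card {X \<in> Pow U. F X = b}))"
    by (simp add: powr_realpow flip: of_nat_sum)
  also have "\<dots> \<le> card (F ` Pow U) * 2 powr (7 / 16 * ?M)"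
    using sum_bounded_above[of "F ` Pow U", OF fiber] by simp
  also have "card (F ` Pow U) < 2 ^ (l + 1)"
  proof -
    have "F ` Pow U \<subseteq> {bs. set bs \<subseteq> UNIV \<and> length bs \<le> l}" using len by auto
    then have "card (F ` Pow U) \<le> card {bs. set bs \<subseteq> (UNIV :: bool set) \<and> length bs \<le> l}"
      by (intro card_mono finite_lists_length_le) auto
    also have "\<dots> = (\<Sum>i\<le>l. 2 ^ i)" by (subst card_lists_length_le) auto
    also have "\<dots> = 2 ^ (l + 1) - 1"
      using sum_power2[of "l + 1"] by (simp add: lessThan_Suc_atMost atLeast0LessThan)
    finally show ?thesis by (simp add: le_less_trans)
  qed
  then have "real (card (F ` Pow U)) < 2 ^ (l + 1)" by (metis of_nat_less_iff of_nat_numeral of_nat_power)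
  then have "card (F ` Pow U) * 2 powr (7 / 16 * ?M) < 2 ^ (l + 1) * 2 powr (7 / 16 * ?M)" by simp
  also have "\<dots> = 2 powr (real (l + 1) + 7 / 16 * ?M)"
    by (simp add: powr_add powr_realpow flip: powr_realpow)
  finally have "2 powr ?M < 2 powr (real (l + 1) + 7 / 16 * ?M)" .
  then show ?thesis by simp
qed

section \<open>The encoding hypergraph and its cuts\<close>

text \<open>The vertices form three blocks: tails \<open>u\<close> in [0, m), private vertices
  \<open>m + x\<close> in [m, 2m), and sums \<open>2 * m + (x + a)\<close> in [2m, 4m).\<close>

definition code_edge :: "nat \<Rightarrow> (nat \<times> nat \<times> nat) set \<Rightarrow> nat \<Rightarrow> nat \<Rightarrow> nat hyperedge" where
  "code_edge m X u x = ({u}, insert (m + x) {2 * m + x + a |a. (u, x, a) \<in> X})"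

text \<open>Every pair \<open>(u, x)\<close> contributes one hyperedge, whatever \<open>X\<close>
  is; only the heads carry information.\<close>

definition code_graph :: "nat \<Rightarrow> nat \<Rightarrow> (nat \<times> nat \<times> nat) set \<Rightarrow> nat hypergraph" where
  "code_graph n m X =
     (let E = (\<lambda>(u, x). code_edge m X u x) ` ({..<m} \<times> {..<m})
      in \<lparr>verts = {..<n}, edges = E, weight = indicator E\<rparr>)"

lemma code_graph_in_hypergraphs_on:
  assumes "1 \<in> W" "4 * m \<le> n" "A \<subseteq> {..<m}" "X \<subseteq> {..<m} \<times> {..<m} \<times> A"
  shows "code_graph n m X \<in> hypergraphs_on n W"
  using assms
  by (fastforce simp: hypergraphs_on_def directed_hypergraph_def code_graph_def code_edge_def Let_def
      indicator_def)

text \<open>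
  The query for the matching \<open>x + 2a = z\<close> at the vertex \<open>u\<close>, restricted to \<open>a \<in> D\<close>: the vertices
  \<open>m + x\<close> outside \<open>S\<close> make sure that every hyperedge not covered by the matching is counted.
\<close>

definition query_complement :: "nat \<Rightarrow> nat set \<Rightarrow> nat \<Rightarrow> nat set \<Rightarrow> nat set" where
  "query_complement m A z D =
     {m + x |x. x < m \<and> (\<forall>a\<in>A. x + 2 * a \<noteq> z)} \<union> {2 * m + y |y. \<exists>a\<in>D. y + a = z \<and> y < 2 * m}"

definition query :: "nat \<Rightarrow> nat \<Rightarrow> nat set \<Rightarrow> nat \<Rightarrow> nat \<Rightarrow> nat set \<Rightarrow> nat set" where
  "query n m A u z D = insert u ({m..<n} - query_complement m A z D)"

text \<open>This is where the matching is induced. Hyperedges outside the matching are hit through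
  their private vertex. If x + 2c = z and the head vertex of x + b is hit through a label
  \<open>a\<close>, then x + b + a = z gives a + b = 2c, so a = b = c and no foreign label can
  interfere.\<close>

lemma code_edge_hits_iff:
  assumes "AP3_free A" "A \<subseteq> {..<m}" "X \<subseteq> {..<m} \<times> {..<m} \<times> A" "D \<subseteq> A" "x < m"
  shows "snd (code_edge m X u x) \<inter> query_complement m A z D \<noteq> {} \<longleftrightarrow>
    (\<forall>a\<in>A. x + 2 * a \<noteq> z) \<or> (\<exists>a\<in>D. (u, x, a) \<in> X \<and> x + 2 * a = z)" (is "?L \<longleftrightarrow> ?R")
proof
  assume ?R
  then show ?L
  proof
    assume "\<forall>a\<in>A. x + 2 * a \<noteq> z"
    then show ?L using assms(5) unfolding code_edge_def query_complement_def by auto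
  next
    assume "\<exists>a\<in>D. (u, x, a) \<in> X \<and> x + 2 * a = z"
    then obtain a where a: "a \<in> D" "(u, x, a) \<in> X" "x + 2 * a = z" by blast
    then have "x + a < 2 * m" using assms by auto
    with a have "2 * m + (x + a) \<in> query_complement m A z D"
      unfolding query_complement_def by auto
    moreover have "2 * m + (x + a) \<in> snd (code_edge m X u x)"
      using a unfolding code_edge_def by auto
    ultimately show ?L by blast
  qed
next
  assume ?L
  then obtain v where v: "v \<in> snd (code_edge m X u x)" "v \<in> query_complement m A z D" by blast
  consider "v = m + x" | b where "v = 2 * m + x + b" "(u, x, b) \<in> X"
    using v(1) unfolding code_edge_def by auto
  then show ?R
  proof cases
    case 1
    then show ?thesis using v(2) assms(5) unfolding query_complement_def by auto
  next
    case 2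
    then obtain a where a: "a \<in> D" "x + b + a = z"
      using v(2) unfolding query_complement_def by auto
    show ?thesis
    proof (cases "\<forall>c\<in>A. x + 2 * c \<noteq> z")
      case False
      then obtain c where c: "c \<in> A" "x + 2 * c = z" by blast
      have "b \<in> A" "a \<in> A" using 2 a assms by auto
      moreover have "b + a = 2 * c" using c a by simp
      ultimately have "b = c" "a = c" using AP3_freeD[OF assms(1)] c by blast+
      then show ?thesis using 2 a c by auto
    qed simp
  qed
qed

lemma cut_code_graph:
  assumes "AP3_free A" "A \<subseteq> {..<m}" "X \<subseteq> {..<m} \<times> {..<m} \<times> A" "D \<subseteq> A" "4 * m \<le> n" "u < m"
  shows "cut (code_graph n m X) (query n m A u z D) =
    real (card {x. x < m \<and> ((\<forall>a\<in>A. x + 2 * a \<noteq> z) \<or> (\<exists>a\<in>D. (u, x, a) \<in> X \<and> x + 2 * a = z))})"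
    (is "_ = real (card ?N)")
proof -
  let ?H = "code_graph n m X" and ?S = "query n m A u z D" and ?T = "query_complement m A z D"
  have T: "?T \<subseteq> {m..<n}" using assms(5) unfolding query_complement_def by auto
  \<comment> \<open>The complement of the query consists of the other tails and \<open>?T\<close>.
    Heads avoid the tail block, so only \<open>?T\<close> matters for them, and \<open>u\<close> is
    the only tail inside the query.\<close>
  have compl: "{..<n} - ?S = ({..<m} - {u}) \<union> ?T"
    using T assms(5,6) unfolding query_def by force
  have hits: "snd (code_edge m X u' x) \<inter> (verts ?H - ?S) = snd (code_edge m X u' x) \<inter> ?T" for u' x
    unfolding code_graph_def Let_def hypergraph.simps compl by (auto simp: code_edge_def)
  have tail: "fst (code_edge m X u' x) \<inter> ?S \<noteq> {} \<longleftrightarrow> u' = u" if "u' < m" for u' x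
    using that unfolding code_edge_def query_def by auto
  have edges: "e \<in> edges ?H \<longleftrightarrow> (\<exists>u' < m. \<exists>x < m. e = code_edge m X u' x)" for e
    by (auto simp: code_graph_def Let_def)
  have "e \<in> edges ?H \<and> fst e \<inter> ?S \<noteq> {} \<and> snd e \<inter> (verts ?H - ?S) \<noteq> {} \<longleftrightarrow>
      (\<exists>x. e = code_edge m X u x \<and> x < m \<and> snd (code_edge m X u x) \<inter> ?T \<noteq> {})" for e
    using tail hits assms(6) unfolding edges by metis
  then have "{e \<in> edges ?H. fst e \<inter> ?S \<noteq> {} \<and> snd e \<inter> (verts ?H - ?S) \<noteq> {}}
      = {code_edge m X u x |x. x < m \<and> snd (code_edge m X u x) \<inter> ?T \<noteq> {}}"
    by blast
  also have "\<dots> = code_edge m X u ` ?N"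
    using code_edge_hits_iff[OF assms(1-4)] by blast
  finally have cut_edges: "{e \<in> edges ?H. fst e \<inter> ?S \<noteq> {} \<and> snd e \<inter> (verts ?H - ?S) \<noteq> {}}
      = code_edge m X u ` ?N" .
  \<comment> \<open>\<open>edges\<close> is a set, so hyperedges with equal heads would be counted
    once; the private vertices keep them apart.\<close>
  have "inj_on (code_edge m X u) ?N"
  proof (rule inj_onI)
    fix x y assume xy: "x \<in> ?N" "y \<in> ?N" "code_edge m X u x = code_edge m X u y"
    have "m + x \<in> snd (code_edge m X u x)" unfolding code_edge_def by simp
    then have "m + x \<in> snd (code_edge m X u y)" unfolding xy(3) .
    then show "x = y" using xy(1,2) unfolding code_edge_def by auto
  qed
  moreover have "weight ?H e = 1" if "e \<in> edges ?H" for e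
    using that unfolding code_graph_def Let_def by simp
  then have "cut ?H ?S = real (card {e \<in> edges ?H. fst e \<inter> ?S \<noteq> {} \<and> snd e \<inter> (verts ?H - ?S) \<noteq> {}})"
    unfolding cut_def by simp
  ultimately show ?thesis unfolding cut_edges by (simp add: card_image)
qed

section \<open>Sets with equal sketches are close\<close>

text \<open>Querying exactly the labels of the triples in \<open>X - Y\<close> gives cut value |N| +
  |P| for \<open>X\<close> but only |N| for \<open>Y\<close>. A common decoded value forces (1 -
  eps)(|N| + |P|) <= (1 + eps)|N|, and both cut values are at most \<open>m\<close>.\<close>

lemma matching_difference_bound:
  assumes scheme: "cut_sketching_scheme n W eps sketch decode"
    and "1 \<in> W" "0 \<le> eps" "4 * m \<le> n" "AP3_free A" "A \<subseteq> {..<m}"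
    and X: "X \<subseteq> {..<m} \<times> {..<m} \<times> A" and Y: "Y \<subseteq> {..<m} \<times> {..<m} \<times> A"
    and same: "sketch (code_graph n m X) = sketch (code_graph n m Y)" and "u < m"
  shows "real (card {(x, a). (u, x, a) \<in> X - Y \<and> x + 2 * a = z}) \<le> 2 * eps * m"
proof -
  define P where "P = {(x, a). (u, x, a) \<in> X - Y \<and> x + 2 * a = z}"
  define D where "D = snd ` P"
  define S where "S = query n m A u z D"
  define N where "N = {x. x < m \<and> (\<forall>a\<in>A. x + 2 * a \<noteq> z)}"
  have D: "D \<subseteq> A" using X unfolding D_def P_def by auto
  \<comment> \<open>For fixed \<open>z\<close> the label \<open>a\<close> determines
    \<open>x\<close>, so no pair outside \<open>P\<close> is selected by \<open>D\<close>.\<close>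
  have D_iff: "a \<in> D \<and> x + 2 * a = z \<longleftrightarrow> (x, a) \<in> P" for x a
    unfolding D_def P_def by force
  have cutX: "cut (code_graph n m X) S = real (card (N \<union> fst ` P))"
  proof -
    have "{x. x < m \<and> ((\<forall>a\<in>A. x + 2 * a \<noteq> z) \<or> (\<exists>a\<in>D. (u, x, a) \<in> X \<and> x + 2 * a = z))}
        = N \<union> fst ` P"
      (is "?L = _")
    proof (rule set_eqI)
      fix x
      have "(\<exists>a\<in>D. (u, x, a) \<in> X \<and> x + 2 * a = z) \<longleftrightarrow> x \<in> fst ` P"
        using D_iff unfolding P_def image_iff by auto
      moreover have "x < m" if "x \<in> fst ` P" using that X unfolding P_def by auto
      ultimately show "x \<in> ?L \<longleftrightarrow> x \<in> N \<union> fst ` P" unfolding N_def by blast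
    qed
    then show ?thesis using cut_code_graph[OF assms(5,6) X D assms(4,10)] unfolding S_def by simp
  qed
  have cutY: "cut (code_graph n m Y) S = real (card N)"
  proof -
    have "{x. x < m \<and> ((\<forall>a\<in>A. x + 2 * a \<noteq> z) \<or> (\<exists>a\<in>D. (u, x, a) \<in> Y \<and> x + 2 * a = z))} = N"
      using D_iff unfolding N_def P_def by auto
    then show ?thesis using cut_code_graph[OF assms(5,6) Y D assms(4,10)] unfolding S_def by simp
  qed
  have NP: "N \<inter> fst ` P = {}" "N \<union> fst ` P \<subseteq> {..<m}"
    using X unfolding N_def P_def by auto
  have fin: "finite N" "finite (fst ` P)" using NP(2) finite_subset by blast+
  have "inj_on fst P" unfolding P_def by (rule inj_onI) auto
  then have "card (fst ` P) = card P" by (rule card_image)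
  then have card: "card (N \<union> fst ` P) = card N + card P"
    using card_Un_disjoint[OF fin NP(1)] by simp
  have le: "card (N \<union> fst ` P) \<le> m" using card_mono[OF _ NP(2)] by simp
  have "verts (code_graph n m Z) = {..<n}" for Z by (simp add: code_graph_def Let_def)
  moreover have "S \<subseteq> {..<n}" using assms(4,10) unfolding S_def query_def by auto
  ultimately have "(1 - eps) * cut (code_graph n m X) S \<le> (1 + eps) * cut (code_graph n m Y) S"
    using scheme same code_graph_in_hypergraphs_on[OF assms(2,4,6) X]
      code_graph_in_hypergraphs_on[OF assms(2,4,6) Y]
    unfolding cut_sketching_scheme_def by (metis order_trans)
  then have "real (card P) \<le> eps * (real (card (N \<union> fst ` P)) + real (card N))"
    unfolding cutX cutY card by (simp add: algebra_simps)
  also have "\<dots> \<le> eps * (real m + real m)"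
    using le card assms(3) by (intro mult_left_mono add_mono) auto
  finally show ?thesis unfolding P_def by simp
qed

text \<open>Since x + 2a < 3m, the triples are covered by m * 3m matchings \<open>(u, z)\<close>,
  each contributing at most \<open>2 * eps * m\<close>.\<close>

lemma difference_bound:
  assumes scheme: "cut_sketching_scheme n W eps sketch decode"
    and "1 \<in> W" "0 \<le> eps" "4 * m \<le> n" "AP3_free A" "A \<subseteq> {..<m}"
    and X: "X \<subseteq> {..<m} \<times> {..<m} \<times> A" and Y: "Y \<subseteq> {..<m} \<times> {..<m} \<times> A"
    and same: "sketch (code_graph n m X) = sketch (code_graph n m Y)"
  shows "real (card (X - Y)) \<le> 6 * eps * m ^ 3"
proof -
  define P where "P = (\<lambda>u z. {(x, a). (u, x, a) \<in> X - Y \<and> x + 2 * a = z})"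
  have "X - Y \<subseteq> (\<Union>(u, z)\<in>{..<m} \<times> {..<3 * m}. Pair u ` P u z)"
  proof
    fix p assume p: "p \<in> X - Y"
    obtain u x a where uxa: "p = (u, x, a)" by (metis prod.exhaust)
    with p X assms(6) have "u < m" "x < m" "a < m" by auto
    with p show "p \<in> (\<Union>(u, z)\<in>{..<m} \<times> {..<3 * m}. Pair u ` P u z)"
      unfolding uxa P_def by (intro UN_I[of "(u, x + 2 * a)"]) auto
  qed
  moreover have fin: "finite (P u z)" for u z
  proof (rule finite_subset)
    show "P u z \<subseteq> {..<m} \<times> A" using X unfolding P_def by auto
    show "finite ({..<m} \<times> A)" using assms(6) finite_subset by blast
  qed
  ultimately have "card (X - Y) \<le> card (\<Union>(u, z)\<in>{..<m} \<times> {..<3 * m}. Pair u ` P u z)"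
    by (intro card_mono) auto
  also have "\<dots> \<le> (\<Sum>(u, z)\<in>{..<m} \<times> {..<3 * m}. card (Pair u ` P u z))"
    using card_UN_le[of "{..<m} \<times> {..<3 * m}" "\<lambda>(u, z). Pair u ` P u z"] by (simp add: case_prod_unfold)
  also have "\<dots> \<le> (\<Sum>(u, z)\<in>{..<m} \<times> {..<3 * m}. card (P u z))"
    using fin by (intro sum_mono) (auto intro: card_image_le)
  finally have "real (card (X - Y)) \<le> (\<Sum>(u, z)\<in>{..<m} \<times> {..<3 * m}. real (card (P u z)))"
    by (simp add: case_prod_unfold flip: of_nat_sum)
  also have "\<dots> \<le> (\<Sum>(u, z)\<in>{..<m} \<times> {..<3 * m}. 2 * eps * m)"
    using matching_difference_bound[OF assms] unfolding P_def by (intro sum_mono) auto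
  also have "\<dots> = 6 * eps * m ^ 3" by (simp add: power3_eq_cube)
  finally show ?thesis .
qed

text \<open>The constant is 192 = 16 * 12: the two one-sided differences together have at most
  \<open>12 * eps * m ^ 3\<close> triples, and this must not exceed a sixteenth of
  \<open>m ^ 2 * card A\<close>.\<close>

lemma sketch_length_lower_bound:
  assumes scheme: "cut_sketching_scheme n W eps sketch decode"
    and "1 \<in> W" "0 \<le> eps" "4 * m \<le> n" "AP3_free A" "A \<subseteq> {..<m}"
    and eps: "192 * eps * m \<le> card A"
    and len: "\<And>H. H \<in> hypergraphs_on n W \<Longrightarrow> length (sketch H) \<le> l"
  shows "9 / 16 * (real m ^ 2 * card A) < l + 1"
proof -
  let ?U = "{..<m} \<times> {..<m} \<times> A"
  have "finite A" using assms(6) finite_subset by blast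
  have card: "card ?U = m ^ 2 * card A" by (simp add: card_cartesian_product power2_eq_square)
  have "9 / 16 * real (card ?U) < real l + 1"
  proof (rule bits_lower_bound[where F = "\<lambda>X. sketch (code_graph n m X)"])
    show "finite ?U" using \<open>finite A\<close> by simp
    show "length (sketch (code_graph n m X)) \<le> l" if "X \<subseteq> ?U" for X
      using len code_graph_in_hypergraphs_on[OF assms(2,4,6) that] by blast
    fix X Y assume XY: "X \<subseteq> ?U" "Y \<subseteq> ?U" "sketch (code_graph n m X) = sketch (code_graph n m Y)"
    have "real (card (sym_diff X Y)) \<le> real (card (X - Y)) + real (card (Y - X))"
      using card_Un_le[of "X - Y" "Y - X"] by linarith
    also have "\<dots> \<le> 12 * eps * m ^ 3"
      using difference_bound[OF assms(1-6) XY] difference_bound[OF assms(1-6) XY(2,1) XY(3)[symmetric]]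
      by simp
    finally have "16 * real (card (sym_diff X Y)) \<le> real m ^ 2 * (192 * eps * m)"
      by (simp add: power3_eq_cube power2_eq_square)
    also have "\<dots> \<le> real m ^ 2 * card A" using eps by (intro mult_left_mono) auto
    finally have "real (16 * card (sym_diff X Y)) \<le> real (card ?U)" unfolding card by simp
    then show "16 * card (sym_diff X Y) \<le> card ?U" by (simp only: of_nat_le_iff)
  qed
  then show ?thesis unfolding card by simp
qed

section \<open>Choice of parameters\<close>

text \<open>Settles small \<open>n\<close> and absorbs the additive 1 of the counting bound. With
  empty sketches only, the edgeless and a one-edge hypergraph would share a decoded value that is
  both nonpositive and positive.\<close>

lemma sketch_length_pos:
  assumes scheme: "cut_sketching_scheme n W eps sketch decode"
    and "1 \<in> W" "eps < 1" "2 \<le> n"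
    and len: "\<And>H. H \<in> hypergraphs_on n W \<Longrightarrow> length (sketch H) \<le> l"
  shows "1 \<le> l"
proof (rule ccontr)
  assume "\<not> 1 \<le> l"
  define G where "G = (\<lambda>E :: nat hyperedge set. \<lparr>verts = {..<n}, edges = E, weight = indicator E\<rparr> :: nat hypergraph)"
  let ?e = "({0}, {1}) :: nat hyperedge"
  have in_G: "G {} \<in> hypergraphs_on n W" "G {?e} \<in> hypergraphs_on n W"
    using assms unfolding G_def hypergraphs_on_def directed_hypergraph_def by (auto simp: indicator_def)
  have "l = 0" using \<open>\<not> 1 \<le> l\<close> by simp
  then have same: "sketch (G {}) = []" "sketch (G {?e}) = []"
    using len[OF in_G(1)] len[OF in_G(2)] by auto
  have "{e. e = ?e \<and> fst e \<inter> {0} \<noteq> {} \<and> snd e \<inter> ({..<n} - {0}) \<noteq> {}} = {?e}"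
    using assms(4) by auto
  then have cut_G: "cut (G {}) {0} = 0" "cut (G {?e}) {0} = 1"
    unfolding cut_def G_def by simp_all
  have sub: "{0} \<subseteq> verts (G E)" for E using assms(4) unfolding G_def by simp
  have "(1 - eps) * cut (G {?e}) {0} \<le> decode [] {0}" "decode [] {0} \<le> (1 + eps) * cut (G {}) {0}"
    using scheme in_G same sub unfolding cut_sketching_scheme_def by metis+
  then show False using assms(3) unfolding cut_G by simp
qed

lemma sketch_length_cubic:
  fixes n s :: nat
  assumes scheme: "cut_sketching_scheme n W (1 / 2 ^ (4 * s + 8)) sketch decode"
    and "1 \<in> W" "1 \<le> s" "2 ^ (s ^ 2) \<le> n" "n < 2 ^ ((s + 1) ^ 2)"
    and len: "\<And>H. H \<in> hypergraphs_on n W \<Longrightarrow> length (sketch H) \<le> l"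
  shows "real n ^ 3 / 2 ^ (19 * s) \<le> l"
proof -
  let ?eps = "1 / 2 ^ (4 * s + 8) :: real"
  have "2 ^ 1 \<le> (2 :: nat) ^ (s ^ 2)" using assms(3) by (intro power_increasing) auto
  then have "2 \<le> n" using assms(4) by simp
  moreover have "?eps < 1" using one_less_power[of "2 :: real" "4 * s + 8"] by simp
  ultimately have pos: "1 \<le> l" using sketch_length_pos[OF scheme assms(2) _ _ len] by blast
  show ?thesis
  proof (cases "s = 1")
    \<comment> \<open>Here n < 16, so n^3 is at most 2^12, below the denominator 2^19.\<close>
    case True
    then have "real n < 16" using assms(5) by (simp add: power2_eq_square)
    then have "real n ^ 3 \<le> 16 ^ 3" by (intro power_mono) auto
    then have "real n ^ 3 / 2 ^ (19 * s) \<le> 1" using True by simp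
    then show ?thesis using pos by linarith
  next
    case False
    \<comment> \<open>Lowering \<open>s\<close> by 2 makes room for the \<open>4 * m\<close>
      vertices, as t(t+1) + 2 <= (t+2)^2.\<close>
    with assms(3) obtain t where t: "s = t + 2" using that[of "s - 2"] by simp
    define m :: nat where "m = 2 ^ (t * (t + 1))"
    obtain A where A: "A \<subseteq> {..<m}" "AP3_free A" "m \<le> 2 ^ (4 * t) * card A"
      using Behrend[of t] unfolding m_def by metis
    have "4 * m = 2 ^ (t * (t + 1) + 2)" unfolding m_def by (simp add: power_add)
    also have "\<dots> \<le> 2 ^ (s ^ 2)" unfolding t
      by (intro power_increasing) (auto simp: power2_eq_square algebra_simps)
    finally have "4 * m \<le> n" using assms(4) by linarith
    have "real n \<le> 2 ^ ((s + 1) ^ 2)" using assms(5) by (metis less_imp_le numeral_power_le_of_nat_cancel_iff of_nat_le_numeral_power_cancel_iff)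
    also have "(s + 1) ^ 2 = t * (t + 1) + (5 * t + 9)" unfolding t by (simp add: power2_eq_square algebra_simps)
    finally have n_le: "real n \<le> real m * 2 ^ (5 * t + 9)" by (simp only: m_def power_add[of _ "t * (t + 1)"] of_nat_power of_nat_numeral)
    have A_ge: "real m \<le> 2 ^ (4 * t) * real (card A)"
      using A(3) by (metis of_nat_le_iff of_nat_mult of_nat_numeral of_nat_power)
    have "192 * ?eps * m \<le> 192 * ?eps * (2 ^ (4 * t) * real (card A))"
      using A_ge by (intro mult_left_mono) auto
    \<comment> \<open>The exponent 4s + 8 = 4t + 16 pays for the density loss 2^(4t) and for 192 <
      2^8.\<close>
    also have "\<dots> \<le> card A" unfolding t by (simp add: power_add field_simps)
    finally have "9 / 16 * (real m ^ 2 * card A) < l + 1"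
      using sketch_length_lower_bound[OF scheme assms(2) _ \<open>4 * m \<le> n\<close> A(2,1) _ len] by simp
    \<comment> \<open>As l + 1 <= 2l, the factor is at most 32/9 < 4.\<close>
    then have l_ge: "real m ^ 2 * card A \<le> 4 * l" using pos by simp
    have "real n ^ 3 \<le> (real m * 2 ^ (5 * t + 9)) ^ 3" using n_le by (intro power_mono) auto
    also have "\<dots> = real m ^ 2 * real m * 2 ^ (15 * t + 27)"
      by (simp add: power_mult_distrib power2_eq_square power3_eq_cube flip: power_mult power_add)
    also have "\<dots> \<le> real m ^ 2 * (2 ^ (4 * t) * real (card A)) * 2 ^ (15 * t + 27)"
      using A_ge by (intro mult_right_mono mult_left_mono) auto
    also have "\<dots> = (real m ^ 2 * card A) * 2 ^ (19 * t + 27)"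
      by (simp flip: power_add)
    also have "\<dots> \<le> (4 * real l) * 2 ^ (19 * t + 27)" using l_ge by (intro mult_right_mono) auto
    \<comment> \<open>The exponent 19 is 3 * 5 from cubing n / m plus 4 from the density of
      \<open>A\<close>; the constants fit since 2 + 27 <= 19 * 2.\<close>
    also have "\<dots> \<le> real l * 2 ^ (19 * s)" unfolding t by (simp add: power_add)
    finally show ?thesis by (simp add: field_simps)
  qed
qed

lemma floor_sqrt_log_bounds:
  fixes n :: nat
  assumes "2 \<le> n"
  defines "s \<equiv> nat \<lfloor>sqrt (log 2 n)\<rfloor>"
  shows "1 \<le> s" "2 ^ (s ^ 2) \<le> n" "n < 2 ^ ((s + 1) ^ 2)"
proof -
  have n: "real n = 2 powr log 2 n" using assms(1) by simp
  have log: "1 \<le> log 2 n" using assms(1) by simp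
  then have "1 \<le> sqrt (log 2 n)" by simp
  then show "1 \<le> s" unfolding s_def by linarith
  have s: "real s \<le> sqrt (log 2 n)" "sqrt (log 2 n) < real (s + 1)"
    using \<open>1 \<le> sqrt (log 2 n)\<close> unfolding s_def by linarith+
  have "real s ^ 2 \<le> log 2 n" using power_mono[OF s(1), of 2] log by simp
  then have "2 powr (real (s ^ 2)) \<le> real n" by (subst n) simp
  then show "2 ^ (s ^ 2) \<le> n"
    by (simp only: powr_realpow numeral_power_le_of_nat_cancel_iff)
  have "sqrt (log 2 n) ^ 2 < real (s + 1) ^ 2" using s(2) log by (intro power_strict_mono) auto
  then have "log 2 n < real ((s + 1) ^ 2)" using log by simp
  then have "real n < 2 powr (real ((s + 1) ^ 2))" by (subst n) simp
  then show "n < 2 ^ ((s + 1) ^ 2)"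
    by (simp only: powr_realpow of_nat_less_numeral_power_cancel_iff)
qed

theorem theorem1p3:
  shows "\<exists>(eps :: nat \<Rightarrow> real) (f :: nat \<Rightarrow> real) (g :: nat \<Rightarrow> real).
    f \<in> O(\<lambda>n. sqrt (log 2 (real n))) \<and>
    g \<in> O(\<lambda>n. sqrt (log 2 (real n))) \<and>
    (\<forall>n. 0 < eps n \<and> eps n < 1 \<and> eps n = 1 / 2 powr f n) \<and>
    (\<forall>n \<ge> 2. \<forall>W sketch decode.
       1 \<in> W \<longrightarrow> W \<subseteq> {0<..} \<longrightarrow>
       cut_sketching_scheme n W (eps n) sketch decode \<longrightarrow>
       ereal (real n ^ 3 / 2 powr g n) \<le> ereal_of_enat (worst_case_space n W sketch))"
proof -
  define s :: "nat \<Rightarrow> nat" where "s = (\<lambda>n. nat \<lfloor>sqrt (log 2 n)\<rfloor>)"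
  define eps :: "nat \<Rightarrow> real" where "eps = (\<lambda>n. 1 / 2 ^ (4 * s n + 8))"
  define f g :: "nat \<Rightarrow> real" where "f = (\<lambda>n. real (4 * s n + 8))" and "g = (\<lambda>n. real (19 * s n))"
  have s: "1 \<le> sqrt (log 2 n)" "real (s n) \<le> sqrt (log 2 n)" if "2 \<le> n" for n :: nat
  proof -
    show "1 \<le> sqrt (log 2 n)" using that by simp
    then show "real (s n) \<le> sqrt (log 2 n)" unfolding s_def by linarith
  qed
  have "f \<in> O(\<lambda>n. sqrt (log 2 (real n)))"
  proof (rule bigoI[where c = 12], rule eventually_sequentiallyI[where c = 2])
    fix n :: nat assume "2 \<le> n"
    \<comment> \<open>12 = 4 + 8, the 8 being absorbed because the root is at least 1.\<close>
    then have "f n \<le> 12 * sqrt (log 2 n)" using s[of n] unfolding f_def by linarith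
    then show "norm (f n) \<le> 12 * norm (sqrt (log 2 (real n)))" using \<open>2 \<le> n\<close> unfolding f_def by simp
  qed
  moreover have "g \<in> O(\<lambda>n. sqrt (log 2 (real n)))"
  proof (rule bigoI[where c = 19], rule eventually_sequentiallyI[where c = 2])
    fix n :: nat assume "2 \<le> n"
    then show "norm (g n) \<le> 19 * norm (sqrt (log 2 (real n)))" using s[of n] unfolding g_def by simp
  qed
  moreover have "0 < eps n \<and> eps n < 1 \<and> eps n = 1 / 2 powr f n" for n
    using one_less_power[of "2 :: real" "4 * s n + 8"] unfolding eps_def f_def powr_realpow[OF zero_less_numeral] by auto
  moreover have "ereal (real n ^ 3 / 2 powr g n) \<le> ereal_of_enat (worst_case_space n W sketch)"
    if "2 \<le> n" "1 \<in> W" and scheme: "cut_sketching_scheme n W (eps n) sketch decode" for n W sketch decode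
  proof (cases "worst_case_space n W sketch")
    \<comment> \<open>A finite supremum bounds every sketch length; an infinite one makes the claim
      trivial.\<close>
    case (enat l)
    have "length (sketch H) \<le> l" if "H \<in> hypergraphs_on n W" for H
      using SUP_upper[OF that, of "\<lambda>H. enat (length (sketch H))"] enat
      unfolding worst_case_space_def by simp
    then have "real n ^ 3 / 2 ^ (19 * s n) \<le> l"
      using sketch_length_cubic[OF scheme[unfolded eps_def] that(2)] floor_sqrt_log_bounds[OF that(1)]
      unfolding s_def by blast
    then show ?thesis unfolding enat g_def by (simp add: powr_realpow flip: of_nat_mult)
  qed simp
  ultimately show ?thesis by blast
qed

end
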